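(* Let $X\in\mathbb{R}^{m\times n}$, $m\ge n$, have full column rank, with $mn\mathbf{u}\le\frac1{64}$ and $n(n+1)\mathbf{u}\le\frac1{64}$. Suppose the shift $s$ satisfies $11(mn\mathbf{u}+n(n+1)\mathbf{u})[X]_g^2\le s\le\frac1{100}[X]_g^2$ and $\kappa_2(X)\le\frac{1}{4.89\,p\,n^2\mathbf{u}}$. Let $Q$ and $R$ be the factors computed in floating-point arithmetic by the improved Shifted CholeskyQR algorithm applied to $X$ with shift $s$. Then $$\|Q^{\top}Q-I\|_2\le 1.6,\qquad \|QR-X\|_F\le 1.67\,p\,n^2\mathbf{u}\,\|X\|_2 .$$
   Context: $\mathbf{u}=2^{-53}$ is the unit roundoff. $\|\cdot\|_2$, $\|\cdot\|_F$ are the spectral and Frobenius norms, $\sigma_1(X)\ge\dots\ge\sigma_n(X)$ the singular values, $\kappa_2(X)=\sigma_1(X)/\sigma_n(X)$. For a matrix $X$ with columns $X_1,\dots,X_n$, $[X]_g:=\max_{1\le j\le n}\|X_j\|_2$, and $p:=[X]_g/\|X\|_2$ (so $1/\sqrt n\le p\le1$). $|A|$ denotes the entrywise absolute value, inequalities between matrices are entrywise, and $\gamma_k:=\frac{k\mathbf{u}}{1-k\mathbf{u}}$, for which the bound $\gamma_k\le1.02k\mathbf{u}$ is used. Improved Shifted CholeskyQR (with shift $s>0$ chosen from $[X]_g$): $B=X^\top X$; $R=\mathrm{Cholesky}(B+sI)$ ($R$ upper triangular); $Q=XR^{-1}$. In floating-point arithmetic (standard model) the computed $B,R,Q$ satisfy: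 - $B=X^\top X+E_A$ with $|E_A|\le\gamma_m|X^\top||X|$; - $R^\top R=B+sI+E_B$ with $|E_B|\le\gamma_{n+1}|R^\top||R|$; - for each $i=1,\dots,m$, $q_i^\top=x_i^\top(R+E_{Ri})^{-1}$ with $|E_{Ri}|\le\gamma_n|R|$, where $q_i^\top,x_i^\top$ are the $i$-th rows of $Q$ and $X$. *)

theory Defs
  imports "HOL-Analysis.Analysis"
begin

definition unit_roundoff :: real where
  "unit_roundoff = 1 / 2 ^ 53"

definition gamma_fp :: "nat \<Rightarrow> real" where
  "gamma_fp k = real k * unit_roundoff / (1 - real k * unit_roundoff)"

definition norm2 :: "real ^ 'n ^ 'm \<Rightarrow> real" where
  "norm2 A = onorm (\<lambda>v. A *v v)"

definition normF :: "real ^ 'n ^ 'm \<Rightarrow> real" where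
  "normF A = sqrt (\<Sum>i\<in>UNIV. \<Sum>j\<in>UNIV. (A $ i $ j)\<^sup>2)"

text \<open>
  The singular values are the square roots of the eigenvalues of \<open>X\<^sup>T X\<close>. They are collected
  without multiplicities: only the extreme ones are used, and for \<open>X\<close> with \<open>n\<close> columns these are
  \<open>\<sigma>\<^sub>1(X)\<close> and \<open>\<sigma>\<^sub>n(X)\<close>.
\<close>

definition singular_values :: "real ^ 'n ^ 'm \<Rightarrow> real set" where
  "singular_values X = {sqrt l | l. \<exists>v. v \<noteq> 0 \<and> (transpose X ** X) *v v = l *\<^sub>R v}"

definition sigma_max :: "real ^ 'n ^ 'm \<Rightarrow> real" where
  "sigma_max X = Max (singular_values X)"

definition sigma_min :: "real ^ 'n ^ 'm \<Rightarrow> real" where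
  "sigma_min X = Min (singular_values X)"

definition kappa2 :: "real ^ 'n ^ 'm \<Rightarrow> real" where
  "kappa2 X = sigma_max X / sigma_min X"

definition normg :: "real ^ 'n ^ 'm \<Rightarrow> real" where
  "normg X = Max (range (\<lambda>j. norm (column j X)))"

definition p_ratio :: "real ^ 'n ^ 'm \<Rightarrow> real" where
  "p_ratio X = normg X / norm2 X"

definition upper_triangular :: "real ^ 'n::{finite,wellorder} ^ 'n::{finite,wellorder} \<Rightarrow> bool" where
  "upper_triangular R \<longleftrightarrow> (\<forall>i j. j < i \<longrightarrow> R $ i $ j = 0)"

text \<open>
  \<open>ISCholeskyQR_fp X s B R Q\<close>: in the standard model of floating-point arithmetic, \<open>B\<close>, \<open>R\<close>, \<open>Q\<close>
  are computed quantities of improved shifted CholeskyQR applied to \<open>X\<close> with shift \<open>s\<close>, described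
  by the backward error bounds of the Gram product, the Cholesky factorization and the row-wise
  triangular solves. The order and absolute value on matrices are the entrywise ones. Invertibility
  of \<open>R + ER i\<close> is not imposed.
\<close>

definition ISCholeskyQR_fp ::
  "real ^ 'n::{finite,wellorder} ^ 'm \<Rightarrow> real
     \<Rightarrow> real ^ 'n::{finite,wellorder} ^ 'n::{finite,wellorder}
     \<Rightarrow> real ^ 'n::{finite,wellorder} ^ 'n::{finite,wellorder}
     \<Rightarrow> real ^ 'n::{finite,wellorder} ^ 'm \<Rightarrow> bool"
where
  "ISCholeskyQR_fp X s B R Q \<longleftrightarrow>
     (\<exists>EA. B = transpose X ** X + EA \<and>
           \<bar>EA\<bar> \<le> gamma_fp CARD('m) *\<^sub>R (\<bar>transpose X\<bar> ** \<bar>X\<bar>)) \<and>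
     upper_triangular R \<and>
     (\<exists>EB. transpose R ** R = B + s *\<^sub>R mat 1 + EB \<and>
           \<bar>EB\<bar> \<le> gamma_fp (CARD('n) + 1) *\<^sub>R (\<bar>transpose R\<bar> ** \<bar>R\<bar>)) \<and>
     (\<exists>ER. \<forall>i. row i Q = row i X v* matrix_inv (R + ER i) \<and>
           \<bar>ER i\<bar> \<le> gamma_fp CARD('n) *\<^sub>R \<bar>R\<bar>)"

end

(*
  Write g = [X]_g and |.|_F for the Frobenius norm. The errors of the Gram product and of the
  Cholesky factorization have Frobenius norm at most s/2 in total, so
  |R v|^2 >= |X v|^2 + (s/2) |v|^2 for all v: R is invertible, X R^-1 is a contraction and the
  smallest singular value of R is at least t = 24 n^2 u g. The errors E_i of the triangular solves
  have Frobenius norm at most e with sqrt(n) e = 1.05 n^2 u g < t/20. Row by row,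
  Q R - X = (- q_i^T E_i)_i, hence |Q R - X|_F <= e |Q|_F, while Q = X R^-1 + (Q R - X) R^-1 gives
  |Q v| <= (1 + |Q R - X|_F / t) |v|. Together these bound both |Q R - X|_F and the spectral norm
  of Q.
*)

theory Submission
  imports Defs
begin

section \<open>The Frobenius norm\<close>

text \<open>The norm of the type \<open>real ^ 'n ^ 'm\<close> is the Euclidean norm of the row
  norms, so \<open>norm\<close> of a matrix means the Frobenius norm throughout.\<close>

lemma normF_eq_norm: "normF A = norm A"
  by (simp add: normF_def norm_vec_def L2_set_def sum_nonneg)

lemma power2_norm_vec: "(norm v)\<^sup>2 = (\<Sum>i\<in>UNIV. (v $ i)\<^sup>2)"
  for v :: "real ^ 'n"
  by (simp add: norm_vec_def L2_set_def sum_nonneg)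

lemma power2_norm_matrix: "(norm A)\<^sup>2 = (\<Sum>i\<in>UNIV. \<Sum>j\<in>UNIV. (A $ i $ j)\<^sup>2)"
  for A :: "real ^ 'n ^ 'm"
  by (simp add: norm_vec_def L2_set_def sum_nonneg)

lemma norm_transpose: "norm (transpose A) = norm A"
  for A :: "real ^ 'n ^ 'm"
proof -
  have "(norm (transpose A))\<^sup>2 = (norm A)\<^sup>2"
    unfolding power2_norm_matrix transpose_def vec_lambda_beta by (rule sum.swap)
  then show ?thesis by simp
qed

lemma power2_norm_rows: "(norm A)\<^sup>2 = (\<Sum>i\<in>UNIV. (norm (row i A))\<^sup>2)"
  for A :: "real ^ 'n ^ 'm"
  by (simp add: power2_norm_matrix power2_norm_vec row_def)

lemma power2_norm_columns: "(norm A)\<^sup>2 = (\<Sum>j\<in>UNIV. (norm (column j A))\<^sup>2)"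
  for A :: "real ^ 'n ^ 'm"
  using power2_norm_rows[of "transpose A"] by (simp add: norm_transpose)

lemma norm_matrix_abs: "norm \<bar>A\<bar> = norm A"
  for A :: "real ^ 'n ^ 'm"
  by (simp add: norm_vec_def abs_vec_def)

lemma norm_matrix_mono:
  fixes A B :: "real ^ 'n ^ 'm"
  assumes "\<bar>A\<bar> \<le> B"
  shows "norm A \<le> norm B"
proof (intro norm_le_componentwise_cart)
  fix i j
  have "\<bar>A $ i $ j\<bar> \<le> B $ i $ j"
    using assms by (simp add: less_eq_vec_def abs_vec_def)
  then show "norm (A $ i $ j) \<le> norm (B $ i $ j)" by simp
qed

lemma norm_matrix_vector_mult_le: "norm (A *v v) \<le> norm A * norm v"
  for A :: "real ^ 'n ^ 'm"
proof (rule power2_le_imp_le)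
  have "(norm (A *v v))\<^sup>2 = (\<Sum>i\<in>UNIV. (row i A \<bullet> v)\<^sup>2)"
    by (simp add: power2_norm_vec inner_vec_def matrix_vector_mult_def row_def)
  also have "\<dots> \<le> (\<Sum>i\<in>UNIV. (norm (row i A))\<^sup>2 * (norm v)\<^sup>2)"
    by (intro sum_mono) (metis Cauchy_Schwarz_ineq power2_norm_eq_inner)
  also have "\<dots> = (norm A * norm v)\<^sup>2"
    by (simp add: power2_norm_rows power_mult_distrib sum_distrib_right)
  finally show "(norm (A *v v))\<^sup>2 \<le> (norm A * norm v)\<^sup>2" .
qed simp

lemma norm_vector_matrix_mult_le: "norm (v v* A) \<le> norm v * norm A"
  for A :: "real ^ 'n ^ 'm"
  using norm_matrix_vector_mult_le[of "transpose A" v] by (simp add: norm_transpose mult.commute)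

lemma row_matrix_matrix_mult: "row i (A ** B) = row i A v* B"
  by (simp add: vec_eq_iff row_def matrix_matrix_mult_def vector_matrix_mult_def mult.commute)

lemma norm_matrix_matrix_mult_le: "norm (A ** B) \<le> norm A * norm B"
  for A :: "real ^ 'n ^ 'm" and B :: "real ^ 'k ^ 'n"
proof (rule power2_le_imp_le)
  have "(norm (A ** B))\<^sup>2 \<le> (\<Sum>i\<in>UNIV. (norm (row i A) * norm B)\<^sup>2)"
    unfolding power2_norm_rows[of "A ** B"] row_matrix_matrix_mult
    by (intro sum_mono power_mono norm_vector_matrix_mult_le) simp
  also have "\<dots> = (norm A * norm B)\<^sup>2"
    by (simp add: power2_norm_rows[of A] power_mult_distrib sum_distrib_right)
  finally show "(norm (A ** B))\<^sup>2 \<le> (norm A * norm B)\<^sup>2" .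
qed simp

lemma trace_transpose_mult: "trace (transpose A ** A) = (norm A)\<^sup>2"
  for A :: "real ^ 'n ^ 'm"
  by (simp add: trace_def matrix_mult_transpose_dot_column power2_norm_columns power2_norm_eq_inner)

lemma inner_transpose_mult: "v \<bullet> ((transpose A ** A) *v v) = (norm (A *v v))\<^sup>2"
  for A :: "real ^ 'n ^ 'm"
  by (metis dot_lmul_matrix inner_commute matrix_vector_mul_assoc power2_norm_eq_inner
      transpose_matrix_vector)

text \<open>The Frobenius norm ignores signs, is monotone in the entries and is submultiplicative.
  The trace is bounded separately because the trace of the Gram matrix of
  \<open>\<bar>A\<bar>\<close> is exactly \<open>(norm A)\<^sup>2\<close>, so no dimension factor is
  lost.\<close>

lemma gram_error_bounds:
  fixes A :: "real ^ 'n ^ 'm" and E :: "real ^ 'n ^ 'n"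
  assumes E: "\<bar>E\<bar> \<le> c *\<^sub>R (\<bar>transpose A\<bar> ** \<bar>A\<bar>)" and c: "0 \<le> c"
  shows "norm E \<le> c * (norm A)\<^sup>2" and "\<bar>trace E\<bar> \<le> c * (norm A)\<^sup>2"
proof -
  have abs_transpose: "\<bar>transpose A\<bar> = transpose \<bar>A\<bar>"
    by (simp add: vec_eq_iff abs_vec_def transpose_def)
  have "norm E \<le> c * norm (transpose \<bar>A\<bar> ** \<bar>A\<bar>)"
    using norm_matrix_mono[OF E] c by (simp add: abs_transpose)
  also have "\<dots> \<le> c * (norm (transpose \<bar>A\<bar>) * norm \<bar>A\<bar>)"
    by (intro mult_left_mono norm_matrix_matrix_mult_le c)
  finally show "norm E \<le> c * (norm A)\<^sup>2"
    by (simp add: norm_transpose norm_matrix_abs power2_eq_square)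
  have "\<bar>trace E\<bar> \<le> (\<Sum>i\<in>UNIV. \<bar>E $ i $ i\<bar>)"
    unfolding trace_def by (rule sum_abs)
  also have "\<dots> \<le> (\<Sum>i\<in>UNIV. c * (transpose \<bar>A\<bar> ** \<bar>A\<bar>) $ i $ i)"
  proof (intro sum_mono)
    fix i
    have "\<bar>E\<bar> $ i $ i \<le> (c *\<^sub>R (transpose \<bar>A\<bar> ** \<bar>A\<bar>)) $ i $ i"
      using E unfolding less_eq_vec_def abs_transpose by blast
    moreover have "\<bar>E\<bar> $ i $ i = \<bar>E $ i $ i\<bar>" by (simp add: abs_vec_def)
    ultimately show "\<bar>E $ i $ i\<bar> \<le> c * (transpose \<bar>A\<bar> ** \<bar>A\<bar>) $ i $ i" by simp
  qed
  also have "\<dots> = c * trace (transpose \<bar>A\<bar> ** \<bar>A\<bar>)"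
    by (simp add: trace_def sum_distrib_left)
  finally show "\<bar>trace E\<bar> \<le> c * (norm A)\<^sup>2"
    by (simp add: trace_transpose_mult norm_matrix_abs)
qed

section \<open>The quantities \<open>normg\<close>, \<open>p_ratio\<close> and
  \<open>gamma_fp\<close>\<close>

lemma power2_norm_le_normg: "(norm X)\<^sup>2 \<le> real CARD('n) * (normg X)\<^sup>2"
  for X :: "real ^ 'n ^ 'm"
proof -
  have "norm (column j X) \<le> normg X" for j
    unfolding normg_def by (rule Max_ge) auto
  then have "(\<Sum>j\<in>UNIV. (norm (column j X))\<^sup>2) \<le> (\<Sum>j\<in>(UNIV :: 'n set). (normg X)\<^sup>2)"
    by (intro sum_mono power_mono) auto
  then show ?thesis by (simp add: power2_norm_columns)
qed

lemma normg_nonneg: "0 \<le> normg X"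
  for X :: "real ^ 'n ^ 'm"
proof -
  have "norm (column j X) \<le> normg X" for j
    unfolding normg_def by (rule Max_ge) auto
  then show ?thesis by (meson norm_ge_zero order_trans)
qed

lemma p_ratio_mult_norm2:
  fixes X :: "real ^ 'n ^ 'm"
  assumes "X \<noteq> 0"
  shows "p_ratio X * norm2 X = normg X"
proof -
  have "norm2 X \<noteq> 0"
    using assms onorm_eq_0[of "(*v) X"]
    by (auto simp: norm2_def matrix_eq)
  then show ?thesis by (simp add: p_ratio_def)
qed

lemma gamma_fp_bounds:
  assumes "real k * unit_roundoff \<le> 1 / 64"
  shows "0 \<le> gamma_fp k" and "gamma_fp k \<le> 51 / 50 * (real k * unit_roundoff)"
proof -
  define x where "x = real k * unit_roundoff"
  have x: "0 \<le> x" "x \<le> 1 / 64" using assms by (auto simp: x_def unit_roundoff_def)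
  \<comment> \<open>Cleared of denominators, the bound with factor 51/50 reads 51 x^2 <= x, which
    holds up to x = 1/51.\<close>
  have "x * (51 * x) \<le> x * 1" using x by (intro mult_left_mono) auto
  then have "x / (1 - x) \<le> 51 / 50 * x" using x by (simp add: field_simps)
  moreover have "0 \<le> x / (1 - x)" using x by simp
  ultimately show "0 \<le> gamma_fp k" "gamma_fp k \<le> 51 / 50 * (real k * unit_roundoff)"
    by (simp_all add: gamma_fp_def x_def)
qed

section \<open>Perturbed Cholesky factors and triangular solves\<close>

text \<open>Taking traces in the factorization identity turns the Gram matrices into squared
  Frobenius norms; the error \<open>EB\<close> is measured by \<open>R\<close> itself, so its share
  moves to the left as the factor \<open>1 - b\<close>. Evaluating the quadratic forms of the same
  identity at \<open>v\<close> gives the second bound.\<close>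

lemma perturbed_cholesky_bounds:
  fixes X :: "real ^ 'n ^ 'm" and R EA EB :: "real ^ 'n ^ 'n"
  assumes R: "transpose R ** R = transpose X ** X + EA + s *\<^sub>R mat 1 + EB"
    and EA: "\<bar>EA\<bar> \<le> a *\<^sub>R (\<bar>transpose X\<bar> ** \<bar>X\<bar>)" "0 \<le> a"
    and EB: "\<bar>EB\<bar> \<le> b *\<^sub>R (\<bar>transpose R\<bar> ** \<bar>R\<bar>)" "0 \<le> b"
  shows "(1 - b) * (norm R)\<^sup>2 \<le> (1 + a) * (norm X)\<^sup>2 + real CARD('n) * s"
    and "(norm (X *v v))\<^sup>2 + (s - a * (norm X)\<^sup>2 - b * (norm R)\<^sup>2) * (norm v)\<^sup>2 \<le> (norm (R *v v))\<^sup>2"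
proof -
  have "(norm R)\<^sup>2 = (norm X)\<^sup>2 + trace EA + trace (s *\<^sub>R mat 1 :: real ^ 'n ^ 'n) + trace EB"
    by (metis R trace_add trace_transpose_mult)
  also have "trace (s *\<^sub>R mat 1 :: real ^ 'n ^ 'n) = real CARD('n) * s"
    by (simp add: trace_def mat_def)
  finally show "(1 - b) * (norm R)\<^sup>2 \<le> (1 + a) * (norm X)\<^sup>2 + real CARD('n) * s"
    using gram_error_bounds(2)[OF EA] gram_error_bounds(2)[OF EB] by (simp add: algebra_simps)
  have quadratic: "- (c * (norm v)\<^sup>2) \<le> v \<bullet> (E *v v)" if "norm E \<le> c" for E :: "real ^ 'n ^ 'n" and c
  proof -
    have "\<bar>v \<bullet> (E *v v)\<bar> \<le> norm v * norm (E *v v)" by (rule Cauchy_Schwarz_ineq2)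
    also have "\<dots> \<le> norm v * (norm E * norm v)"
      by (intro mult_left_mono norm_matrix_vector_mult_le) simp
    also have "\<dots> \<le> norm v * (c * norm v)"
      using that by (intro mult_left_mono mult_right_mono) auto
    finally show ?thesis by (simp add: power2_eq_square mult_ac)
  qed
  have "(norm (R *v v))\<^sup>2 = (norm (X *v v))\<^sup>2 + v \<bullet> (EA *v v) + s * (norm v)\<^sup>2 + v \<bullet> (EB *v v)"
    unfolding inner_transpose_mult[symmetric] R
    by (simp add: matrix_vector_mult_add_rdistrib inner_add_right power2_norm_eq_inner
        scaleR_matrix_vector_assoc[symmetric])
  then show "(norm (X *v v))\<^sup>2 + (s - a * (norm X)\<^sup>2 - b * (norm R)\<^sup>2) * (norm v)\<^sup>2 \<le> (norm (R *v v))\<^sup>2"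
    using quadratic[OF gram_error_bounds(1)[OF EA]] quadratic[OF gram_error_bounds(1)[OF EB]]
    by (simp add: algebra_simps)
qed

lemma invertible_if_bounded_below:
  fixes A :: "real ^ 'n ^ 'n"
  assumes "0 < t" and "\<And>v. t * norm v \<le> norm (A *v v)"
  shows "invertible A"
  unfolding invertible_left_inverse matrix_left_invertible_ker
proof (intro allI impI)
  fix v assume "A *v v = 0"
  then have "t * norm v \<le> 0" using assms(2)[of v] by simp
  then show "v = 0" using \<open>0 < t\<close> by (simp add: mult_le_0_iff)
qed

lemma matrix_inv_left:
  assumes "invertible A"
  shows "matrix_inv A ** A = mat 1"
  using assms unfolding invertible_def matrix_inv_def by (rule someI2_ex) auto

text \<open>Cancelling the inverse shows that row i of the residual is minus row i of
  \<open>Q\<close> times \<open>E i\<close>. The perturbation changes with the row, so the estimate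
  is summed over the rows, and this brings in the Frobenius norm of \<open>Q\<close>.\<close>

lemma residual_le:
  fixes X Q :: "real ^ 'n ^ 'm" and R :: "real ^ 'n ^ 'n"
  assumes solve: "\<And>i. row i Q = row i X v* matrix_inv (R + E i)"
    and inv: "\<And>i. invertible (R + E i)"
    and E: "\<And>i. norm (E i) \<le> e"
  shows "norm (Q ** R - X) \<le> e * norm Q"
proof (rule power2_le_imp_le)
  have e: "0 \<le> e" using E by (meson norm_ge_zero order_trans)
  show "0 \<le> e * norm Q" using e by simp
  have row_le: "norm (row i (Q ** R - X)) \<le> e * norm (row i Q)" for i
  proof -
    have "row i X = row i Q v* R + row i Q v* E i"
      unfolding vector_matrix_mult_add_rdistrib[symmetric]
      by (simp add: solve vector_matrix_mul_assoc matrix_inv_left[OF inv])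
    moreover have "row i (Q ** R - X) = row i Q v* R - row i X"
      unfolding row_matrix_matrix_mult[symmetric] by (simp add: vec_eq_iff row_def)
    ultimately have "row i (Q ** R - X) = - (row i Q v* E i)"
      by simp
    then have "norm (row i (Q ** R - X)) \<le> norm (row i Q) * norm (E i)"
      by (simp add: norm_vector_matrix_mult_le)
    also have "\<dots> \<le> norm (row i Q) * e" by (intro mult_left_mono E) simp
    finally show ?thesis by (simp add: mult.commute)
  qed
  have "(norm (Q ** R - X))\<^sup>2 \<le> (\<Sum>i\<in>UNIV. (e * norm (row i Q))\<^sup>2)"
    unfolding power2_norm_rows[of "Q ** R - X"]
    by (rule sum_mono, rule power_mono[OF row_le norm_ge_zero])
  also have "\<dots> = (e * norm Q)\<^sup>2"
    by (simp add: power2_norm_rows[of Q] power_mult_distrib sum_distrib_left)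
  finally show "(norm (Q ** R - X))\<^sup>2 \<le> (e * norm Q)\<^sup>2" .
qed

text \<open>Substituting \<open>v = R w\<close> gives \<open>Q v = X w + (Q R - X) w\<close>.\<close>

lemma norm_mult_le_residual:
  fixes X Q :: "real ^ 'n ^ 'm" and R :: "real ^ 'n ^ 'n"
  assumes t: "0 < t" and R: "\<And>v. (norm (X *v v))\<^sup>2 + (t * norm v)\<^sup>2 \<le> (norm (R *v v))\<^sup>2"
  shows "norm (Q *v v) \<le> (1 + norm (Q ** R - X) / t) * norm v"
proof -
  \<comment> \<open>Each square on the left of \<open>R\<close> is dropped in turn: one bound makes
    \<open>X\<close> times the inverse of \<open>R\<close> a contraction, the other bounds that
    inverse by 1/t.\<close>
  have XR: "norm (X *v w) \<le> norm (R *v w)" for w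
    by (rule power2_le_imp_le) (use R[of w] zero_le_power2[of "t * norm w"] in linarith, simp)
  have tR: "t * norm w \<le> norm (R *v w)" for w
    by (rule power2_le_imp_le) (use R[of w] zero_le_power2[of "norm (X *v w)"] in linarith, simp)
  have "invertible R" by (rule invertible_if_bounded_below[OF t tR])
  then obtain R' where R': "R ** R' = mat 1" unfolding invertible_def by blast
  define w where "w = R' *v v"
  have v: "R *v w = v" by (simp add: w_def matrix_vector_mul_assoc R')
  have "(Q ** R - X) *v w = Q *v v - X *v w"
    by (simp only: matrix_vector_mult_diff_rdistrib matrix_vector_mul_assoc[symmetric] v)
  then have "norm (Q *v v) \<le> norm (X *v w) + norm ((Q ** R - X) *v w)"
    using norm_triangle_ineq[of "X *v w" "(Q ** R - X) *v w"] by simp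
  also have "\<dots> \<le> norm v + norm (Q ** R - X) * (norm v / t)"
  proof (rule add_mono)
    show "norm (X *v w) \<le> norm v" using XR[of w] by (simp only: v)
    have "norm w \<le> norm v / t" using tR[of w] t unfolding v by (simp add: field_simps)
    then have "norm (Q ** R - X) * norm w \<le> norm (Q ** R - X) * (norm v / t)"
      by (rule mult_left_mono) simp
    then show "norm ((Q ** R - X) *v w) \<le> norm (Q ** R - X) * (norm v / t)"
      by (rule order_trans[OF norm_matrix_vector_mult_le])
  qed
  finally show ?thesis by (simp add: algebra_simps)
qed

text \<open>The columns are the images of the unit vectors, so each has norm at most
  \<open>c\<close>, and there are \<open>CARD('n)\<close> of them.\<close>

lemma norm_le_of_norm_mult_le:
  fixes Q :: "real ^ 'n ^ 'm"
  assumes "\<And>v. norm (Q *v v) \<le> c * norm v"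
  shows "norm Q \<le> sqrt (real CARD('n)) * c"
proof -
  have col: "norm (column j Q) \<le> c" for j
    using assms[of "axis j 1"] by (simp add: matrix_vector_mult_basis)
  then have c: "0 \<le> c" by (meson norm_ge_zero order_trans)
  have "(norm Q)\<^sup>2 \<le> (\<Sum>j\<in>(UNIV :: 'n set). c\<^sup>2)"
    unfolding power2_norm_columns by (intro sum_mono power_mono col) simp
  also have "\<dots> = (sqrt (real CARD('n)) * c)\<^sup>2" by (simp add: power_mult_distrib)
  finally show ?thesis by (rule power2_le_imp_le) (use c in simp)
qed

text \<open>
  With \<open>S = Q\<^sup>T Q - I\<close> one has \<open>|S v|\<^sup>2 = |Q\<^sup>T Q v|\<^sup>2 - 2 |Q v|\<^sup>2 + |v|\<^sup>2\<close>, and the first two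
  terms add up to at most 0 as soon as \<open>|Q|\<^sup>2 \<le> 2\<close>.
\<close>

lemma norm2_gram_minus_id_le_1:
  fixes Q :: "real ^ 'n ^ 'm"
  assumes Q: "\<And>v. norm (Q *v v) \<le> c * norm v" and c: "c\<^sup>2 \<le> 2"
  shows "norm2 (transpose Q ** Q - mat 1) \<le> 1"
  unfolding norm2_def
proof (rule onorm_le)
  fix v
  define y where "y = transpose Q *v (Q *v v)"
  \<comment> \<open>Moving one transpose across the inner product bounds \<open>transpose Q\<close>
    by the same constant \<open>c\<close> as \<open>Q\<close>, once a factor \<open>norm y\<close>
    is cancelled.\<close>
  have "(norm y)\<^sup>2 = (Q *v v) \<bullet> (Q *v y)"
    unfolding power2_norm_eq_inner
    by (metis y_def dot_lmul_matrix transpose_matrix_vector)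
  also have "\<dots> \<le> norm (Q *v v) * norm (Q *v y)" by (rule norm_cauchy_schwarz)
  also have "\<dots> \<le> norm (Q *v v) * (c * norm y)" by (intro mult_left_mono Q) simp
  finally have le: "norm y * norm y \<le> (c * norm (Q *v v)) * norm y"
    by (simp add: power2_eq_square mult_ac)
  \<comment> \<open>Any unit vector serves here; it only yields \<open>0 \<le> c\<close>.\<close>
  have "norm (Q *v axis undefined 1) \<le> c" using Q[of "axis undefined 1"] by simp
  then have c0: "0 \<le> c" by (meson norm_ge_zero order_trans)
  have "norm y \<le> c * norm (Q *v v)"
    using le c0 by (cases "norm y = 0") (auto simp: mult_le_cancel_right)
  then have "(norm y)\<^sup>2 \<le> c\<^sup>2 * (norm (Q *v v))\<^sup>2"
    by (metis norm_ge_zero power_mono power_mult_distrib)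
  also have "\<dots> \<le> 2 * (norm (Q *v v))\<^sup>2" using c by (intro mult_right_mono) auto
  finally have y: "(norm y)\<^sup>2 \<le> 2 * (norm (Q *v v))\<^sup>2" .
  have yv: "y \<bullet> v = (norm (Q *v v))\<^sup>2"
    unfolding power2_norm_eq_inner y_def by (simp add: dot_lmul_matrix)
  have "(transpose Q ** Q - mat 1) *v v = y - v"
    by (simp add: y_def matrix_vector_mul_assoc[symmetric] matrix_vector_mult_diff_rdistrib)
  moreover have "(norm (y - v))\<^sup>2 \<le> (norm v)\<^sup>2"
    using y yv by (simp add: power2_norm_eq_inner inner_diff_left inner_diff_right inner_commute)
  ultimately show "norm ((transpose Q ** Q - mat 1) *v v) \<le> 1 * norm v" by simp
qed

text \<open>The residual is bounded by the size of \<open>Q\<close>, and \<open>Q\<close> by 1 plus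
  a multiple of the residual. Inserting one bound into the other leaves the residual on the right
  with a factor of at most 1/20, which is absorbed on the left.\<close>

lemma perturbed_solve_bounds:
  fixes X Q :: "real ^ 'n ^ 'm" and R :: "real ^ 'n ^ 'n"
  assumes t: "0 < t" and R: "\<And>v. (norm (X *v v))\<^sup>2 + (t * norm v)\<^sup>2 \<le> (norm (R *v v))\<^sup>2"
    and solve: "\<And>i. row i Q = row i X v* matrix_inv (R + E i)"
    and E: "\<And>i. norm (E i) \<le> e" and e: "20 * (sqrt (real CARD('n)) * e) \<le> t"
  shows "norm (Q ** R - X) \<le> 53 / 50 * (sqrt (real CARD('n)) * e)"
    and "norm (Q *v v) \<le> 53 / 50 * norm v"
proof -
  have e0: "0 \<le> e" using E by (meson norm_ge_zero order_trans)
  \<comment> \<open>In this proof \<open>n\<close> is the square root of the number of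
    columns.\<close>
  define n where "n = sqrt (real CARD('n))"
  have n: "1 \<le> n" by (simp add: n_def Suc_le_eq)
  have "1 * e \<le> n * e" using n e0 by (intro mult_right_mono) auto
  then have te: "e \<le> t / 20" using e by (simp add: n_def)
  \<comment> \<open>A perturbation of size at most t/20 cannot destroy the lower bound
    \<open>t\<close> of \<open>R\<close>; half of it survives.\<close>
  have inv: "invertible (R + E i)" for i
  proof (rule invertible_if_bounded_below[where t = "t / 2"])
    show "0 < t / 2" using t by simp
    fix v
    have "t * norm v \<le> norm (R *v v)"
      by (rule power2_le_imp_le) (use R[of v] zero_le_power2[of "norm (X *v v)"] in linarith, simp)
    moreover have "norm (E i *v v) \<le> t / 2 * norm v"
      using norm_matrix_vector_mult_le[of "E i" v] mult_right_mono[of "norm (E i)" "t / 2" "norm v"]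
        E[of i] te t by auto
    moreover have "norm (R *v v) \<le> norm ((R + E i) *v v) + norm (E i *v v)"
      using norm_triangle_ineq4[of "(R + E i) *v v" "E i *v v"]
      by (simp add: matrix_vector_mult_add_rdistrib)
    ultimately show "t / 2 * norm v \<le> norm ((R + E i) *v v)" by simp
  qed
  define d where "d = norm (Q ** R - X)"
  have Q: "norm (Q *v v) \<le> (1 + d / t) * norm v" for v
    unfolding d_def by (rule norm_mult_le_residual[OF t R])
  have "d \<le> e * norm Q"
    unfolding d_def by (rule residual_le[OF solve inv E])
  also have "\<dots> \<le> e * (n * (1 + d / t))"
    unfolding n_def by (intro mult_left_mono norm_le_of_norm_mult_le Q e0)
  also have "\<dots> = n * e + n * e / t * d" by (simp add: algebra_simps)
  also have "\<dots> \<le> n * e + 1 / 20 * d"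
  proof (intro add_left_mono mult_right_mono)
    show "n * e / t \<le> 1 / 20" using e t by (simp add: n_def field_simps)
  qed (simp add: d_def)
  finally have "d \<le> n * e + 1 / 20 * d" .
  moreover have "0 \<le> n * e" using n e0 by simp
  \<comment> \<open>Absorption costs the factor 20/19, which is below 53/50.\<close>
  ultimately have d: "d \<le> 53 / 50 * (n * e)" by linarith
  then show "norm (Q ** R - X) \<le> 53 / 50 * (sqrt (real CARD('n)) * e)" by (simp add: d_def n_def)
  \<comment> \<open>The exact value is at most 53/50 * 1/20 = 0.053.\<close>
  have "d / t \<le> 3 / 50" using d e t by (simp add: n_def field_simps)
  then have "(1 + d / t) * norm v \<le> 53 / 50 * norm v" by (intro mult_right_mono) auto
  with Q[of v] show "norm (Q *v v) \<le> 53 / 50 * norm v" by linarith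
qed

section \<open>Rounding error analysis\<close>

theorem theorem1:
  fixes X Q :: "real ^ 'n::{finite,wellorder} ^ 'm::finite"
    and B R :: "real ^ 'n::{finite,wellorder} ^ 'n::{finite,wellorder}"
    and s :: real
  assumes "CARD('n) \<le> CARD('m)"
    and "rank X = CARD('n)"
    and "real CARD('m) * real CARD('n) * unit_roundoff \<le> 1 / 64"
    and "real CARD('n) * (real CARD('n) + 1) * unit_roundoff \<le> 1 / 64"
    and "11 * (real CARD('m) * real CARD('n) * unit_roundoff
             + real CARD('n) * (real CARD('n) + 1) * unit_roundoff) * (normg X)\<^sup>2 \<le> s"
    and "s \<le> 1 / 100 * (normg X)\<^sup>2"
    and "kappa2 X \<le> 1 / (4.89 * p_ratio X * (real CARD('n))\<^sup>2 * unit_roundoff)"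
    and "ISCholeskyQR_fp X s B R Q"
  shows "norm2 (transpose Q ** Q - mat 1) \<le> 1.6 \<and>
         normF (Q ** R - X) \<le> 1.67 * p_ratio X * (real CARD('n))\<^sup>2 * unit_roundoff * norm2 X"
proof -

  \<comment> \<open>Notation and smallness of the roundoff terms\<close>
  define u where "u = unit_roundoff"
  define n where "n = real CARD('n)"
  define m where "m = real CARD('m)"
  define g where "g = normg X"
  have u: "0 < u" by (simp add: u_def unit_roundoff_def)
  have n: "1 \<le> n" by (simp add: n_def Suc_le_eq)
  have nm: "n \<le> m" using assms(1) by (simp add: n_def m_def)
  have mnu: "m * n * u \<le> 1 / 64" and nnu: "n * (n + 1) * u \<le> 1 / 64"
    and s_ge: "11 * (m * n * u + n * (n + 1) * u) * g\<^sup>2 \<le> s" and s_le: "s \<le> 1 / 100 * g\<^sup>2"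
    using assms(3-6) by (simp_all add: n_def m_def u_def g_def)
  \<comment> \<open>Dropping factors that are at least 1 from the products bounds
    \<open>m * u\<close>, \<open>(n + 1) * u\<close> and \<open>n * u\<close>, the arguments at
    which \<open>gamma_fp_bounds\<close> is applied.\<close>
  have "m * u * 1 \<le> m * u * n" using u n nm by (intro mult_left_mono) auto
  then have mu: "m * u \<le> 1 / 64" using mnu by (simp add: mult_ac)
  have "1 * ((n + 1) * u) \<le> n * ((n + 1) * u)" using u n by (intro mult_right_mono) auto
  then have nu1: "(n + 1) * u \<le> 1 / 64" using nnu by (simp only: mult.assoc mult_1_left)
  have "n * u \<le> (n + 1) * u" using u by simp
  then have nu: "n * u \<le> 1 / 64" using nu1 by (rule order_trans)
  have "n\<^sup>2 * u \<le> n * (n + 1) * u"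
    unfolding power2_eq_square using u n by (intro mult_right_mono mult_left_mono) auto
  then have n2u: "n\<^sup>2 * u \<le> 1 / 64" using nnu by (rule order_trans)
  have X: "X \<noteq> 0" using assms(2) by auto
  have XF: "(norm X)\<^sup>2 \<le> n * g\<^sup>2" unfolding n_def g_def by (rule power2_norm_le_normg)
  have "0 < n * g\<^sup>2" using XF X by (smt (verit) zero_less_norm_iff zero_less_power)
  then have g: "0 < g" using normg_nonneg[of X] by (auto simp: g_def less_le)

  \<comment> \<open>Error matrices and their coefficients\<close>
  from assms(8) obtain EA EB ER where
    gram: "transpose R ** R = transpose X ** X + EA + s *\<^sub>R mat 1 + EB"
    and EA: "\<bar>EA\<bar> \<le> gamma_fp CARD('m) *\<^sub>R (\<bar>transpose X\<bar> ** \<bar>X\<bar>)"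
    and EB: "\<bar>EB\<bar> \<le> gamma_fp (CARD('n) + 1) *\<^sub>R (\<bar>transpose R\<bar> ** \<bar>R\<bar>)"
    and solve: "\<And>i. row i Q = row i X v* matrix_inv (R + ER i)"
    and ER: "\<And>i. \<bar>ER i\<bar> \<le> gamma_fp CARD('n) *\<^sub>R \<bar>R\<bar>"
    unfolding ISCholeskyQR_fp_def by metis
  define a where "a = gamma_fp CARD('m)"
  define b where "b = gamma_fp (CARD('n) + 1)"
  define c where "c = gamma_fp CARD('n)"
  have a: "0 \<le> a" "a \<le> 51 / 50 * (m * u)"
    using gamma_fp_bounds[of "CARD('m)"] mu by (auto simp: a_def m_def u_def)
  have b: "0 \<le> b" "b \<le> 51 / 50 * ((n + 1) * u)"
    using gamma_fp_bounds[of "CARD('n) + 1"] nu1 by (auto simp: b_def n_def u_def add.commute)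
  have c: "0 \<le> c" "c \<le> 51 / 50 * (n * u)"
    using gamma_fp_bounds[of "CARD('n)"] nu by (auto simp: c_def n_def u_def)
  note chol = perturbed_cholesky_bounds[OF gram EA[folded a_def] a(1) EB[folded b_def] b(1)]

  \<comment> \<open>The size of \<open>R\<close> and the part of the shift that survives the
    errors\<close>
  have RF: "(norm R)\<^sup>2 \<le> 21 / 20 * (n * g\<^sup>2)"
  proof -
    \<comment> \<open>Both \<open>a\<close> and \<open>b\<close> are at most 1.02/64 < 2/125, whence
      123/125 and 127/125; finally (1.016 + 0.01) / 0.984 < 21/20.\<close>
    have "123 / 125 * (norm R)\<^sup>2 \<le> (1 - b) * (norm R)\<^sup>2"
      using b nu1 by (intro mult_right_mono) auto
    also have "\<dots> \<le> (1 + a) * (norm X)\<^sup>2 + n * s" using chol(1) by (simp add: n_def)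
    also have "\<dots> \<le> 127 / 125 * (n * g\<^sup>2) + 1 / 100 * (n * g\<^sup>2)"
    proof (rule add_mono)
      show "(1 + a) * (norm X)\<^sup>2 \<le> 127 / 125 * (n * g\<^sup>2)"
        using a mu XF by (intro mult_mono) auto
      have "n * s \<le> n * (1 / 100 * g\<^sup>2)"
        using s_le n by (intro mult_left_mono) auto
      then show "n * s \<le> 1 / 100 * (n * g\<^sup>2)" by simp
    qed
    finally show ?thesis using \<open>0 < n * g\<^sup>2\<close> by linarith
  qed

  have pos: "0 < m * n * u * g\<^sup>2" "0 < n * (n + 1) * u * g\<^sup>2"
    using u n nm g by simp_all
  have shift: "a * (norm X)\<^sup>2 + b * (norm R)\<^sup>2 \<le> s / 2"
  proof -
    have "a * (norm X)\<^sup>2 \<le> 51 / 50 * (m * u) * (n * g\<^sup>2)"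
      using a \<open>0 < n * g\<^sup>2\<close> by (intro mult_mono[OF a(2) XF]) simp_all
    also have "\<dots> = 51 / 50 * (m * n * u * g\<^sup>2)" by (simp only: mult_ac)
    finally have "a * (norm X)\<^sup>2 \<le> 51 / 50 * (m * n * u * g\<^sup>2)" .
    moreover have "b * (norm R)\<^sup>2 \<le> 51 / 50 * ((n + 1) * u) * (21 / 20 * (n * g\<^sup>2))"
      using b \<open>0 < n * g\<^sup>2\<close> by (intro mult_mono[OF b(2) RF]) simp_all
    then have "b * (norm R)\<^sup>2 \<le> 1071 / 1000 * (n * (n + 1) * u * g\<^sup>2)"
      by (simp add: algebra_simps)
    moreover have "11 * (m * n * u * g\<^sup>2) + 11 * (n * (n + 1) * u * g\<^sup>2) \<le> s"
      using s_ge by (simp only: distrib_left distrib_right mult.assoc)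
    \<comment> \<open>The coefficients 1.02 and 1.02 * 1.05 = 1.071 both stay below 11/2, half of
      the factor in the lower bound on \<open>s\<close>.\<close>
    ultimately show ?thesis using pos by linarith
  qed

  \<comment> \<open>As \<open>m \<ge> n\<close>, the lower bound on \<open>s\<close> gives \<open>s/2 \<ge> 9 n\<^sup>2 u g\<^sup>2\<close>; the constant 24 comes from
    \<open>9 \<ge> 24\<^sup>2 n\<^sup>2 u\<close>, which is \<open>n\<^sup>2 u \<le> 1/64\<close>.\<close>
  define t where "t = 24 * n\<^sup>2 * u * g"
  have t: "0 < t" using n u g by (simp add: t_def)
  have ts: "t\<^sup>2 \<le> s / 2"
  proof -
    have "t\<^sup>2 = 576 * (n\<^sup>2 * u) * (n\<^sup>2 * u * g\<^sup>2)" by (simp add: t_def power_mult_distrib power2_eq_square)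
    also have "\<dots> \<le> 9 * (n\<^sup>2 * u * g\<^sup>2)" 
    proof (rule mult_right_mono)
      show "576 * (n\<^sup>2 * u) \<le> 9" using n2u by linarith
    qed (use u in simp)
    also have "\<dots> \<le> s / 2"
    proof -
      have "n\<^sup>2 * (u * g\<^sup>2) \<le> m * n * (u * g\<^sup>2)"
        unfolding power2_eq_square using u n nm by (intro mult_right_mono) auto
      moreover have "n\<^sup>2 * (u * g\<^sup>2) \<le> n * (n + 1) * (u * g\<^sup>2)"
        unfolding power2_eq_square using u n by (intro mult_right_mono mult_left_mono) auto
      moreover have "11 * (m * n * (u * g\<^sup>2)) + 11 * (n * (n + 1) * (u * g\<^sup>2)) \<le> s"
        using s_ge by (simp only: distrib_left distrib_right mult.assoc)
      moreover have "0 \<le> n\<^sup>2 * (u * g\<^sup>2)" using u by simp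
      ultimately show ?thesis unfolding mult.assoc by linarith
    qed
    finally show ?thesis .
  qed
  have R: "(norm (X *v v))\<^sup>2 + (t * norm v)\<^sup>2 \<le> (norm (R *v v))\<^sup>2" for v
  proof -
    have "t\<^sup>2 * (norm v)\<^sup>2 \<le> (s - a * (norm X)\<^sup>2 - b * (norm R)\<^sup>2) * (norm v)\<^sup>2"
      using ts shift by (intro mult_right_mono) auto
    then show ?thesis using chol(2)[of v] by (simp add: power_mult_distrib)
  qed

  \<comment> \<open>Errors of the triangular solves and the final constants\<close>
  define e where "e = 21 / 20 * (n * u * (sqrt n * g))"
  have E: "norm (ER i) \<le> e" for i
  proof -
    \<comment> \<open>41/40 is a rational upper bound for the square root of 21/20; then 1.02 *
      1.025 = 1.0455 explains the factor 21/20 in \<open>e\<close>.\<close>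
    have "norm R \<le> 41 / 40 * (sqrt n * g)"
    proof (rule power2_le_imp_le)
      have "21 / 20 * (n * g\<^sup>2) \<le> (41 / 40)\<^sup>2 * (n * g\<^sup>2)"
        using n by (intro mult_right_mono) (auto simp: power2_eq_square)
      moreover have "(41 / 40 * (sqrt n * g))\<^sup>2 = (41 / 40)\<^sup>2 * (n * g\<^sup>2)"
        using n by (simp only: power_mult_distrib) simp
      ultimately show "(norm R)\<^sup>2 \<le> (41 / 40 * (sqrt n * g))\<^sup>2"
        using RF by linarith
    qed (use n g in simp)
    then have "c * norm R \<le> (51 / 50 * (n * u)) * (41 / 40 * (sqrt n * g))"
      using c u n by (intro mult_mono) auto
    also have "\<dots> \<le> e" using n u g by (simp add: e_def)
    finally show ?thesis
      using norm_matrix_mono[OF ER[of i]] c(1) by (simp add: c_def norm_matrix_abs)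
  qed
  have ne: "sqrt n * e = 21 / 20 * (n\<^sup>2 * u * g)"
    using n by (simp add: e_def power2_eq_square)
  \<comment> \<open>By \<open>ne\<close> the left side is 21 \<open>n\<^sup>2 * u * g\<close>,
    against 24 in \<open>t\<close>.\<close>
  have "20 * (sqrt (real CARD('n)) * e) \<le> t"
    using n u g unfolding n_def[symmetric] ne by (simp add: t_def)
  note bounds = perturbed_solve_bounds[OF t R solve E this]
  have "normF (Q ** R - X) \<le> 53 / 50 * (21 / 20 * (n\<^sup>2 * u * g))"
    using bounds(1) unfolding normF_eq_norm n_def[symmetric] ne .
  also have "\<dots> \<le> 1.67 * (n\<^sup>2 * u * g)" using n u g by simp
  also have "\<dots> = 1.67 * p_ratio X * (real CARD('n))\<^sup>2 * unit_roundoff * norm2 X"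
    unfolding g_def p_ratio_mult_norm2[OF X, symmetric] n_def u_def by simp
  \<comment> \<open>Since (53/50)^2 = 1.1236 <= 2, the deviation from orthogonality is even at most
    1.\<close>
  finally show ?thesis
    using norm2_gram_minus_id_le_1[of Q "53 / 50", OF bounds(2)] by (simp add: power2_eq_square)
qed

end
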